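(* Let $\mathcal{O}$ be a one-counter system with $n$ states. Suppose a configuration $\beta=(p_\beta,0)$ is reachable from a configuration $\alpha=(p_\alpha,0)$ in $\mathcal{O}$. Then $\mathcal{O}$ has a path from $\alpha$ to $\beta$ of length at most $14n^2$.
   Context: $\mathbb{N}=\{0,1,2,\dots\}$. A one-counter system (OCS) $\mathcal{O}$ consists of a finite set $Q$ of states, a set $T_{>0}\subseteq Q\times\{-1,0,1\}\times Q$ of non-zero transitions and a set $T_{=0}\subseteq Q\times\{0,1\}\times Q$ of zero tests; $T=T_{>0}\cup T_{=0}$. A configuration is a pair $(q,c)\in Q\times\mathbb{N}$, with state $q$ and counter value $c$. A transition $t=(p,d,q)\in T$ can be fired in configuration $(p,c)$ if either $t\in T_{>0}$ and $c>0$, or $t\in T_{=0}$ and $c=0$; the result is $(q,c+d)$, and we write $(p,c)\xrightarrow{t}(q,c+d)$. A path is a sequence $(\gamma_1,t_1)(\gamma_2,t_2)\cdots(\gamma_m,t_m)$ of configurations and transitions such that there are configurations with $\gamma_i\xrightarrow{t_i}\gamma_{i+1}$ for $i=1,\dots,m$; its source is $\gamma_1$, its target is $\gamma_{m+1}$, its length is $m$, and it is a path from its source to its target. A configuration $\beta$ is reachable from $\alpha$ if there is a path from $\alpha$ to $\beta$ (the length-$0$ path witnesses $\alpha$ reachable from itself). *)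

theory Defs
  imports Main
begin

type_synonym 'q trans = "'q \<times> int \<times> 'q"
type_synonym 'q config = "'q \<times> nat"

record 'q ocs =
  states :: "'q set"
  tpos :: "'q trans set"
  tzero :: "'q trans set"

definition wf_ocs :: "'q ocs \<Rightarrow> bool" where
  "wf_ocs S \<longleftrightarrow> finite (states S)
     \<and> tpos S \<subseteq> states S \<times> {-1, 0, 1} \<times> states S
     \<and> tzero S \<subseteq> states S \<times> {0, 1} \<times> states S"

definition transitions :: "'q ocs \<Rightarrow> 'q trans set" where
  "transitions S = tpos S \<union> tzero S"

definition step :: "'q ocs \<Rightarrow> 'q config \<Rightarrow> 'q trans \<Rightarrow> 'q config \<Rightarrow> bool" where
  "step S \<gamma> t \<gamma>' \<longleftrightarrow>
     (case t of (p, d, q) \<Rightarrow>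
        fst \<gamma> = p \<and>
        ((t \<in> tpos S \<and> snd \<gamma> > 0) \<or> (t \<in> tzero S \<and> snd \<gamma> = 0)) \<and>
        int (snd \<gamma>) + d \<ge> 0 \<and>
        \<gamma>' = (q, nat (int (snd \<gamma>) + d)))"

fun is_path :: "'q ocs \<Rightarrow> 'q config \<Rightarrow> ('q config \<times> 'q trans) list \<Rightarrow> 'q config \<Rightarrow> bool" where
  "is_path S \<alpha> [] \<beta> \<longleftrightarrow> \<alpha> = \<beta>"
| "is_path S \<alpha> ((\<gamma>, t) # \<pi>) \<beta> \<longleftrightarrow>
     \<gamma> = \<alpha> \<and> (\<exists>\<gamma>'. step S \<gamma> t \<gamma>' \<and> is_path S \<gamma>' \<pi> \<beta>)"

definition reachable :: "'q ocs \<Rightarrow> 'q config \<Rightarrow> 'q config \<Rightarrow> bool" where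
  "reachable S \<alpha> \<beta> \<longleftrightarrow> (\<exists>\<pi>. is_path S \<alpha> \<pi> \<beta>)"

end

theory Submission
  imports Defs "HOL-Number_Theory.Cong"
begin

text \<open>Let \<open>n\<close> be the number of states. Configurations with counter at most \<open>n + 1\<close> are low. An
  excursion above level \<open>n\<close> passes, while still low, through a state whose strongly connected
  component \<open>K\<close> (for the positive transitions) contains a cycle of gain \<open>a > 0\<close>, at a level
  exceeding \<open>card K\<close>; symmetrically it leaves through a component with a cycle of gain \<open>- b < 0\<close>.
  With enough copies of the two cycles any walk between two such points whose effect is right modulo
  \<open>gcd a b\<close> can be realised, so the excursion is forgotten and only a \<open>jump\<close> between two low
  configurations is kept.

  In a shortest sequence of low steps and jumps all low configurations are distinct, which bounds
  the number of low steps by \<open>n (n + 2)\<close>. If the walks realising the \<open>i\<close>-th and the \<open>j\<close>-th jump,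
  \<open>i < j\<close>, met in a state at levels congruent modulo \<open>gcd a\<^sub>i b\<^sub>j\<close>, there would be a single jump
  from the start of the former to the end of the latter. Hence the walks starting in a component
  \<open>K\<close> together visit every state at most \<open>a\<^sub>K\<close> times, and \<open>a\<^sub>K\<close> sums to at most \<open>n\<close> over all \<open>K\<close>.
  This bounds the total length of the walks by \<open>n\<^sup>2\<close> and the total cost of the cycles by
  \<open>9 n\<^sup>2\<close>; another \<open>2 n\<^sup>2\<close> pays for the detours inside the components to the cycles.\<close>

section \<open>Walks in graphs with unit weights\<close>

fun walk :: "'q trans set \<Rightarrow> 'q \<Rightarrow> 'q trans list \<Rightarrow> 'q \<Rightarrow> bool" where
  "walk E p [] q \<longleftrightarrow> p = q"
| "walk E p ((r, d, s) # es) q \<longleftrightarrow> r = p \<and> (p, d, s) \<in> E \<and> walk E s es q"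

text \<open>The end node as a total function, so that the intermediate nodes of a walk have the
  names \<open>tgt p (take t es)\<close>.\<close>

fun tgt :: "'q \<Rightarrow> 'q trans list \<Rightarrow> 'q" where
  "tgt p [] = p"
| "tgt p ((r, d, s) # es) = tgt s es"

fun eff :: "'q trans list \<Rightarrow> int" where
  "eff [] = 0"
| "eff ((r, d, s) # es) = d + eff es"

text \<open>The last level must be positive as well, so that safety of a concatenation splits into
  safety of its parts.\<close>

fun psafe :: "int \<Rightarrow> 'q trans list \<Rightarrow> bool" where
  "psafe c [] \<longleftrightarrow> c \<ge> 1"
| "psafe c ((r, d, s) # es) \<longleftrightarrow> c \<ge> 1 \<and> psafe (c + d) es"

text \<open>Reversing the edges and negating the weights turns descents into ascents, so each result
  on climbing also serves for coming down.\<close>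

fun flip :: "'q trans \<Rightarrow> 'q trans" where
  "flip (p, d, q) = (q, - d, p)"

definition rwalk :: "'q trans list \<Rightarrow> 'q trans list" where
  "rwalk es = rev (map flip es)"

definition scc :: "'q trans set \<Rightarrow> 'q \<Rightarrow> 'q set" where
  "scc E p = {q. (\<exists>es. walk E p es q) \<and> (\<exists>es. walk E q es p)}"

text \<open>The effect matters only modulo \<open>g\<close>, because pumped cycles will supply the
  missing multiple of \<open>g\<close>.\<close>

definition conn :: "'q trans set \<Rightarrow> int \<Rightarrow> 'q \<Rightarrow> int \<Rightarrow> 'q \<Rightarrow> bool" where
  "conn E g p e q \<longleftrightarrow> (\<exists>es. walk E p es q \<and> [eff es = e] (mod g))"

section \<open>Prefixes, safety and reversal of walks\<close>

lemma tgt_append [simp]: "tgt p (xs @ ys) = tgt (tgt p xs) ys"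
  by (induction p xs rule: tgt.induct) auto

lemma eff_append [simp]: "eff (xs @ ys) = eff xs + eff ys"
  by (induction xs rule: eff.induct) auto

lemma walk_tgt: "walk E p es q \<Longrightarrow> tgt p es = q"
  by (induction E p es q rule: walk.induct) auto

lemma walk_append: "walk E p (xs @ ys) q \<longleftrightarrow> walk E p xs (tgt p xs) \<and> walk E (tgt p xs) ys q"
  by (induction E p xs q rule: walk.induct) auto

lemma walk_appendI: "walk E p xs q \<Longrightarrow> walk E q ys r \<Longrightarrow> walk E p (xs @ ys) r"
  using walk_tgt walk_append by metis

lemma walk_take: "walk E p es q \<Longrightarrow> walk E p (take t es) (tgt p (take t es))"
  and walk_drop: "walk E p es q \<Longrightarrow> walk E (tgt p (take t es)) (drop t es) q"
  using walk_append[of E p "take t es" "drop t es" q] by simp_all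

lemma eff_drop: "eff (drop t es) = eff es - eff (take t es)"
  using eff_append[of "take t es" "drop t es"] by simp

lemma walk_mid:
  assumes "walk E p es q" "s \<le> t"
  shows "walk E (tgt p (take s es)) (drop s (take t es)) (tgt p (take t es))"
  using walk_drop[OF walk_take[OF assms(1), of t], of s] assms(2) by (simp add: min_def)

lemma psafe_append: "psafe c (xs @ ys) \<longleftrightarrow> psafe c xs \<and> psafe (c + eff xs) ys"
proof (induction c xs rule: psafe.induct)
  case (1 c)
  show ?case by (cases ys rule: eff.cases) auto
qed (auto simp: add.assoc)

lemma psafe_start: "psafe c es \<Longrightarrow> c \<ge> 1"
  by (cases es rule: eff.cases) auto

lemma psafe_iff: "psafe c es \<longleftrightarrow> (\<forall>t \<le> length es. c + eff (take t es) \<ge> 1)"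
proof (induction c es rule: psafe.induct)
  case (2 c r d s es)
  have "(\<forall>t \<le> Suc n. P t) \<longleftrightarrow> P 0 \<and> (\<forall>t \<le> n. P (Suc t))" for n and P :: "nat \<Rightarrow> bool"
    by (auto, case_tac t, auto)
  then show ?case using 2 by (simp add: add.assoc)
qed simp

lemma walk_rwalk: "walk E p es q \<Longrightarrow> walk (flip ` E) q (rwalk es) p"
proof (induction E p es q rule: walk.induct)
  case (2 E p r d s es q)
  then have "walk (flip ` E) q (rwalk es) s" by simp
  from 2 have "flip (p, d, s) \<in> flip ` E" by (intro imageI) simp
  then have "walk (flip ` E) q (rwalk es @ [(s, - d, p)]) p"
    by (intro walk_appendI[of _ q _ s]) (use 2 in simp_all)
  then show ?case using 2 by (simp add: rwalk_def)
qed (simp add: rwalk_def)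

lemma flip_flip [simp]: "flip (flip e) = e"
  by (cases e) auto

lemma flip_flip_image [simp]: "flip ` flip ` E = E"
  by (simp add: image_image)

lemma rwalk_rwalk [simp]: "rwalk (rwalk es) = es"
  by (simp add: rwalk_def rev_map comp_def)

lemma length_rwalk [simp]: "length (rwalk es) = length es"
  by (simp add: rwalk_def)

lemma rwalk_append: "rwalk (xs @ ys) = rwalk ys @ rwalk xs"
  by (simp add: rwalk_def)

lemma eff_rwalk [simp]: "eff (rwalk es) = - eff es"
  by (induction es rule: eff.induct) (auto simp: rwalk_def)

lemma psafe_rwalk: "psafe c es \<Longrightarrow> psafe (c + eff es) (rwalk es)"
proof (induction c es rule: psafe.induct)
  case (2 c r d s es)
  have "psafe (c + d + eff es) (rwalk es @ [(s, - d, r)])"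
    unfolding psafe_append using 2 psafe_start[of "c + d" es] by simp
  then show ?case by (simp add: rwalk_def add.assoc)
qed (simp add: rwalk_def)

section \<open>Connections modulo \<open>g\<close>\<close>

lemma conn_trans:
  assumes "conn E g p e q" "conn E g q f r"
  shows "conn E g p (e + f) r"
  using assms unfolding conn_def by (metis walk_appendI eff_append cong_add)

lemma conn_cong: "conn E g p e q \<Longrightarrow> [e = f] (mod g) \<Longrightarrow> conn E g p f q"
  unfolding conn_def using cong_trans by blast

lemma conn_walk: "walk E p es q \<Longrightarrow> conn E g p (eff es) q"
  unfolding conn_def by auto

lemma conn_mod: "conn E g p e q \<Longrightarrow> g' dvd g \<Longrightarrow> conn E g' p e q"
  unfolding conn_def using cong_dvd_modulus by blast

lemma conn_power:
  assumes "conn E g p e p" shows "conn E g p (int k * e) p"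
proof (induction k)
  case 0
  show ?case using conn_walk[of E p "[]" p g] by simp
next
  case (Suc k)
  show ?case using conn_trans[OF assms Suc] by (simp add: algebra_simps)
qed

text \<open>The connection followed by \<open>es\<close> is closed. Going round it
  \<open>g - 1\<close> times and then once along \<open>es\<close> gives an effect congruent to
  \<open>- e\<close>, so connections are invertible modulo \<open>g\<close> inside a
  component.\<close>

lemma conn_back:
  assumes "conn E g p e q" "walk E q es p" "g > 0"
  shows "conn E g q (- e) p"
proof -
  have "conn E g q (int (nat (g - 1)) * (eff es + e)) q"
    by (intro conn_power conn_trans[OF conn_walk[OF assms(2)] assms(1)])
  from conn_trans[OF this conn_walk[OF assms(2)]]
  have "conn E g q ((g - 1) * (eff es + e) + eff es) p" using assms(3) by simp
  moreover have "(g - 1) * (eff es + e) + eff es - - e = g * (eff es + e)"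
    by (simp add: algebra_simps)
  ultimately show ?thesis
    by (elim conn_cong) (simp add: cong_iff_dvd_diff)
qed

section \<open>Strongly connected components\<close>

lemma scc_refl: "p \<in> scc E p"
  unfolding scc_def by (auto intro: exI[of _ "[]"])

lemma scc_eq: "q \<in> scc E p \<Longrightarrow> scc E q = scc E p"
  unfolding scc_def by (blast intro: walk_appendI)

lemma scc_flip: "scc (flip ` E) p = scc E p"
proof -
  have "\<And>E p. scc E p \<subseteq> scc (flip ` E) p"
    unfolding scc_def by (auto dest: walk_rwalk)
  from this[of E p] this[of "flip ` E" p] show ?thesis by simp
qed

lemma scc_closed_walk:
  assumes "walk E p es q" "q \<in> scc E p"
  shows "tgt p (take t es) \<in> scc E p"
proof -
  obtain fs where "walk E q fs p" using assms(2) unfolding scc_def by auto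
  then have "walk E (tgt p (take t es)) (drop t es @ fs) p"
    by (rule walk_appendI[OF walk_drop[OF assms(1)]])
  then show ?thesis using walk_take[OF assms(1)] unfolding scc_def by blast
qed

text \<open>Take a shortest such walk: the segment between two visits of a node at congruent levels
  could be cut out without changing the effect modulo \<open>g\<close>.\<close>

lemma minimal_walk:
  assumes "conn E g p e q"
  obtains es where "walk E p es q" "[eff es = e] (mod g)"
    "\<And>s t. s < t \<Longrightarrow> t \<le> length es \<Longrightarrow> tgt p (take s es) = tgt p (take t es) \<Longrightarrow>
       \<not> [eff (take s es) = eff (take t es)] (mod g)"
proof -
  let ?P = "\<lambda>es. walk E p es q \<and> [eff es = e] (mod g)"
  obtain es where es: "?P es" and min: "\<And>fs. ?P fs \<Longrightarrow> length es \<le> length fs"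
    using assms ex_has_least_nat[of ?P _ length] unfolding conn_def by blast
  have "\<not> [eff (take s es) = eff (take t es)] (mod g)"
    if st: "s < t" "t \<le> length es" and eq: "tgt p (take s es) = tgt p (take t es)" for s t
  proof
    assume c: "[eff (take s es) = eff (take t es)] (mod g)"
    let ?fs = "take s es @ drop t es"
    have "walk E p ?fs q"
      using walk_appendI[OF walk_take[of E p es q s]] walk_drop[of E p es q t] es eq by simp
    moreover have "[eff ?fs = eff es] (mod g)"
      using c cong_add_rcancel[of "eff (take s es)" "eff es - eff (take t es)" "eff (take t es)" g]
      by (simp add: eff_drop algebra_simps)
    ultimately have "length es \<le> length ?fs" using es min cong_trans by blast
    then show False using st by simp
  qed
  then show ?thesis using that es by blast
qed

section \<open>Pumping cycles\<close>

text \<open>Safety from every \<open>c \<ge> 1\<close> says that the cycle never falls below its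
  starting level.\<close>

definition pumps :: "'q trans set \<Rightarrow> 'q set \<Rightarrow> 'q \<Rightarrow> 'q trans list \<Rightarrow> bool" where
  "pumps E K u A \<longleftrightarrow> u \<in> K \<and> walk E u A u \<and> eff A > 0 \<and> length A \<le> card K \<and> (\<forall>c \<ge> 1. psafe c A)"

text \<open>Choosing one anchor and one cycle per component makes all jumps that leave the same
  component share a node, which is what allows them to be counted.\<close>

definition anchor :: "'q trans set \<Rightarrow> 'q set \<Rightarrow> 'q" where
  "anchor E K = (SOME u. \<exists>A. pumps E K u A)"

definition loop :: "'q trans set \<Rightarrow> 'q set \<Rightarrow> 'q trans list" where
  "loop E K = (SOME A. pumps E K (anchor E K) A)"

definition gain :: "'q trans set \<Rightarrow> 'q set \<Rightarrow> int" where
  "gain E K = eff (loop E K)"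

definition pumpable :: "'q trans set \<Rightarrow> 'q set \<Rightarrow> bool" where
  "pumpable E K \<longleftrightarrow> (\<exists>u A. pumps E K u A)"

lemma pumpable_loop: "pumpable E K \<Longrightarrow> pumps E K (anchor E K) (loop E K)"
  unfolding pumpable_def anchor_def loop_def by (metis (mono_tags, lifting) someI_ex)

section \<open>Short cycles of positive effect\<close>

locale unit_graph =
  fixes Q :: "'q set" and E :: "'q trans set"
  assumes finite_Q: "finite Q" and E_sub: "E \<subseteq> Q \<times> {-1, 0, 1} \<times> Q"
begin

lemma flip_graph: "unit_graph Q (flip ` E)"
  using finite_Q E_sub by unfold_locales auto

lemma walk_in_Q: "walk E p es q \<Longrightarrow> p \<in> Q \<Longrightarrow> q \<in> Q"
proof (induction es arbitrary: p)
  case (Cons e es)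
  then show ?case using E_sub by (cases e) auto
qed simp

lemma eff_bound: "walk E p es q \<Longrightarrow> \<bar>eff es\<bar> \<le> int (length es)"
proof (induction es arbitrary: p)
  case (Cons e es)
  obtain r d s where e: "e = (r, d, s)" by (cases e)
  then have "\<bar>eff es\<bar> \<le> int (length es)" "d \<in> {-1, 0, 1}"
    using Cons E_sub by auto
  then show ?case using e by auto
qed simp

lemma scc_sub_Q: "p \<in> Q \<Longrightarrow> scc E p \<subseteq> Q"
  unfolding scc_def using walk_in_Q by blast

lemma finite_scc: "p \<in> Q \<Longrightarrow> finite (scc E p)"
  using scc_sub_Q finite_Q finite_subset by blast

lemma short_walk:
  assumes "p \<in> Q" "q \<in> scc E p"
  obtains es where "walk E p es q" "length es < card (scc E p)"
proof -
  obtain fs where "walk E p fs q" using assms unfolding scc_def by auto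
  \<comment> \<open>Modulo 1 all levels are congruent, so a minimal walk repeats no node.\<close>
  then have "conn E 1 p (eff fs) q" by (rule conn_walk)
  then obtain es where es: "walk E p es q" and
    ne: "\<And>s t. s < t \<Longrightarrow> t \<le> length es \<Longrightarrow> tgt p (take s es) \<noteq> tgt p (take t es)"
    by (rule minimal_walk) auto
  have "inj_on (\<lambda>t. tgt p (take t es)) {..length es}"
    by (rule linorder_inj_onI) (use ne in auto)
  moreover have "(\<lambda>t. tgt p (take t es)) ` {..length es} \<subseteq> scc E p"
    using scc_closed_walk[OF es assms(2)] by auto
  ultimately have "card {..length es} \<le> card (scc E p)"
    by (rule card_inj_on_le[OF _ _ finite_scc[OF assms(1)]])
  then show ?thesis using that es by simp
qed

lemma psafe_high: "walk E p es q \<Longrightarrow> c > int (length es) \<Longrightarrow> psafe c es"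
proof -
  assume w: "walk E p es q" and c: "c > int (length es)"
  have "c + eff (take t es) \<ge> 1" if "t \<le> length es" for t
    using eff_bound[OF walk_take[OF w], of t] c that by simp
  then show ?thesis by (simp add: psafe_iff)
qed

text \<open>The reversed walk starts at the high end and visits the same levels.\<close>

lemma psafe_high_end:
  assumes "walk E p es q" "c + eff es > int (length es)" shows "psafe c es"
proof -
  interpret rev: unit_graph Q "flip ` E" by (rule flip_graph)
  have "psafe (c + eff es) (rwalk es)"
    using rev.psafe_high[OF walk_rwalk[OF assms(1)]] assms(2) by simp
  from psafe_rwalk[OF this] show ?thesis by simp
qed

text \<open>Start the cycle at a position where its level is minimal. After wrapping around, the
  positive total effect only raises the levels further.\<close>

lemma rotate_loop:
  assumes w: "walk E r es r" and pos: "eff es > 0"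
  obtains t where "t \<le> length es" "\<And>c. c \<ge> 1 \<Longrightarrow> psafe c (drop t es @ take t es)"
proof -
  let ?P = "\<lambda>t. eff (take t es)"
  obtain t where t: "t \<le> length es" and min: "\<And>s. s \<le> length es \<Longrightarrow> ?P t \<le> ?P s"
    using ex_min_if_finite[of "?P ` {..length es}"] by (auto simp: not_less) 
  have nonneg: "eff (take s (drop t es @ take t es)) \<ge> 0" if s: "s \<le> length es" for s
  proof (cases "s \<le> length es - t")
    case True
    then have "eff (take s (drop t es)) = ?P (t + s) - ?P t"
      by (simp add: take_add)
    then show ?thesis using True min[of "t + s"] t by simp
  next
    case False
    then have "eff (take s (drop t es @ take t es)) = eff es - ?P t + ?P (s - (length es - t))"
      using t s by (simp add: eff_drop min_def)
    moreover have "s - (length es - t) \<le> length es" using s by simp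
    ultimately show ?thesis using min[of "s - (length es - t)"] pos by linarith
  qed
  have "psafe c (drop t es @ take t es)" if "c \<ge> 1" for c
    unfolding psafe_iff
  proof (intro allI impI)
    fix s assume "s \<le> length (drop t es @ take t es)"
    with t have "s \<le> length es" by simp
    with nonneg[of s] that show "1 \<le> c + eff (take s (drop t es @ take t es))" by linarith
  qed
  then show ?thesis using that t by blast
qed

text \<open>A shortest closed walk of positive effect is a simple cycle: a repeated node would split
  it into two shorter closed walks, one of them of positive effect. Rotation then makes it
  safe.\<close>

lemma positive_loop:
  assumes "p \<in> Q" "q \<in> scc E p" "walk E q fs q" "eff fs > 0"
  shows "pumpable E (scc E p)"
proof -
  let ?K = "scc E p"
  let ?P = "\<lambda>es. (\<exists>r \<in> ?K. walk E r es r) \<and> eff es > 0"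
  obtain es where es: "?P es" and min: "\<And>gs. ?P gs \<Longrightarrow> length es \<le> length gs"
    using assms ex_has_least_nat[of ?P _ length] by blast
  then obtain r where r: "r \<in> ?K" "walk E r es r" by blast
  have K: "tgt r (take t es) \<in> ?K" for t
    using scc_closed_walk[OF r(2) scc_refl] scc_eq[OF r(1)] by simp
  let ?x = "\<lambda>t. tgt r (take t es)"
  \<comment> \<open>Position 0 is left out since it carries the same node as the last
    position.\<close>
  have "?x s \<noteq> ?x t" if st: "s < t" "0 < s" "t \<le> length es" for s t
  proof
    assume eq: "?x s = ?x t"
    have "walk E r (take s es @ drop t es) r"
      using walk_appendI[OF walk_take[OF r(2), of s]] walk_drop[OF r(2), of t] eq by simp
    moreover have "walk E (?x s) (drop s (take t es)) (?x s)"
      using walk_mid[OF r(2), of s t] st eq by simp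
    moreover have "eff (take s es @ drop t es) + eff (drop s (take t es)) = eff es"
      using st by (simp add: eff_drop min_def)
    moreover have "length (take s es @ drop t es) < length es" "length (drop s (take t es)) < length es"
      using st by auto
    ultimately have "eff (take s es @ drop t es) \<le> 0" "eff (drop s (take t es)) \<le> 0"
      using min r(1) K by (meson not_le)+
    then show False
      using \<open>eff _ + eff _ = eff es\<close> es by linarith
  qed
  then have "inj_on ?x {1..length es}"
    by (intro linorder_inj_onI) auto
  moreover have "?x ` {1..length es} \<subseteq> ?K" using K by auto
  ultimately have "card {1..length es} \<le> card ?K"
    by (rule card_inj_on_le[OF _ _ finite_scc[OF assms(1)]])
  then have len: "length es \<le> card ?K" by simp
  obtain t where t: "t \<le> length es" "\<And>c. c \<ge> 1 \<Longrightarrow> psafe c (drop t es @ take t es)"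
    using rotate_loop[OF r(2)] es by blast
  have "pumps E ?K (?x t) (drop t es @ take t es)"
    unfolding pumps_def using K t len es walk_appendI[OF walk_drop[OF r(2)] walk_take[OF r(2)], of t t]
    by (auto simp: eff_drop)
  then show ?thesis unfolding pumpable_def by blast
qed

lemma sum_card_scc:
  assumes "\<K> \<subseteq> scc E ` Q" shows "(\<Sum>K\<in>\<K>. card K) \<le> card Q"
proof -
  have "\<forall>K\<in>\<K>. \<forall>L\<in>\<K>. K \<noteq> L \<longrightarrow> K \<inter> L = {}"
  proof (intro ballI impI)
    fix K L assume "K \<in> \<K>" "L \<in> \<K>" "K \<noteq> L"
    then obtain k l where kl: "K = scc E k" "L = scc E l" using assms by blast
    show "K \<inter> L = {}"
    proof (rule ccontr)
      assume "K \<inter> L \<noteq> {}"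
      then obtain z where "z \<in> scc E k" "z \<in> scc E l" using kl by auto
      then show False using scc_eq[of z E k] scc_eq[of z E l] kl \<open>K \<noteq> L\<close> by simp
    qed
  qed
  moreover have fin: "finite \<K>" "\<And>K. K \<in> \<K> \<Longrightarrow> finite K"
    using assms finite_Q finite_scc by (auto intro: finite_subset)
  ultimately have "(\<Sum>K\<in>\<K>. card K) = card (\<Union>\<K>)"
    using card_UN_disjoint[of \<K> "\<lambda>K. K"] by simp
  also have "\<dots> \<le> card Q"
    using assms scc_sub_Q by (intro card_mono finite_Q) blast
  finally show ?thesis .
qed

lemma pumps_gain:
  assumes "pumpable E K"
  shows "gain E K > 0" "gain E K \<le> int (length (loop E K))" "length (loop E K) \<le> card K"
    and "anchor E K \<in> K" "walk E (anchor E K) (loop E K) (anchor E K)"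
    and "\<And>c. c \<ge> 1 \<Longrightarrow> psafe c (loop E K)"
  using pumpable_loop[OF assms] eff_bound[of "anchor E K" "loop E K" "anchor E K"]
  unfolding pumps_def gain_def by auto

lemma pump_run:
  assumes "pumpable E K"
  obtains es where "walk E (anchor E K) es (anchor E K)" "eff es = int k * gain E K"
    "\<And>c. c \<ge> 1 \<Longrightarrow> psafe c es" "length es = k * length (loop E K)"
proof (induction k arbitrary: thesis)
  case 0
  show ?case by (rule 0[of "[]"]) auto
next
  case (Suc k)
  obtain es where es: "walk E (anchor E K) es (anchor E K)" "eff es = int k * gain E K"
    "\<And>c. c \<ge> 1 \<Longrightarrow> psafe c es" "length es = k * length (loop E K)"
    using Suc.IH by blast
  show ?case
  proof (rule Suc.prems[of "loop E K @ es"])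
    show "walk E (anchor E K) (loop E K @ es) (anchor E K)"
      by (rule walk_appendI[OF pumps_gain(5)[OF assms] es(1)])
    show "eff (loop E K @ es) = int (Suc k) * gain E K"
      using es(2) by (simp add: gain_def algebra_simps)
    show "length (loop E K @ es) = Suc k * length (loop E K)" using es(4) by simp
    show "psafe c (loop E K @ es)" if "c \<ge> 1" for c
      using es(3) pumps_gain(1,6)[OF assms] that by (simp add: psafe_append gain_def)
  qed
qed

end

text \<open>Bezout solves \<open>x * a - y * b = D\<close>. Solutions can be shifted so that
  \<open>x * a\<close> moves by the least common multiple \<open>a * (b div gcd a b)\<close>, hence
  into the window of that length above \<open>T\<close>; \<open>T \<ge> 0\<close> and
  \<open>T \<ge> D\<close> make both counts non-negative.\<close>

lemma pump_counts:
  fixes a b D T :: int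
  assumes "a > 0" "b > 0" "gcd a b dvd D" "T \<ge> 0" "T \<ge> D"
  obtains x y :: nat where "int x * a = D + int y * b" "T \<le> int x * a"
    "int x * a < T + a * (b div gcd a b)"
proof -
  let ?g = "gcd a b"
  obtain k where k: "D = ?g * k" using assms(3) by blast
  obtain u v where uv: "u * a + v * b = ?g" using bezout_int by blast
  define b' a' where "b' = b div ?g" and "a' = a div ?g"
  have ab: "a * b' = b * a'"
    unfolding a'_def b'_def by (metis div_mult_swap dvd_div_mult gcd_dvd1 gcd_dvd2 mult.commute)
  have "b' > 0" using assms(1,2) by (simp add: b'_def pos_imp_zdiv_pos_iff zdvd_imp_le)
  then have pos: "a * b' > 0" using assms(1) by simp
  \<comment> \<open>The shift by \<open>q\<close> periods leaves \<open>a * X - T\<close> equal to a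
    remainder modulo \<open>a * b'\<close>.\<close>
  define q where "q = (a * (u * k) - T) div (a * b')"
  define X Y where "X = u * k - b' * q" and "Y = - v * k - a' * q"
  have r: "a * X = T + (a * (u * k) - T) mod (a * b')"
    using mult_div_mod_eq[of "a * b'" "a * (u * k) - T"] by (simp add: X_def q_def algebra_simps)
  have "a * X - b * Y = (u * a + v * b) * k + (b * a' - a * b') * q"
    by (simp add: X_def Y_def algebra_simps)
  then have D: "a * X - b * Y = D" using uv k ab by simp
  have bd: "T \<le> a * X" "a * X < T + a * b'"
    using r pos pos_mod_bound[OF pos] pos_mod_sign[OF pos] by simp_all
  then have "0 \<le> a * X" "0 \<le> b * Y" using D assms(4,5) by linarith+
  then have "X \<ge> 0" "Y \<ge> 0" using assms(1,2) by (simp_all add: zero_le_mult_iff)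
  then show ?thesis
    using that[of "nat X" "nat Y"] D bd by (simp add: b'_def algebra_simps)
qed

section \<open>Jumps\<close>

text \<open>The lower bound leaves room for a simple walk inside the component to the anchor; the
  upper bound says that the configuration is low.\<close>

definition ready :: "'q set \<Rightarrow> 'q trans set \<Rightarrow> 'q config \<Rightarrow> bool" where
  "ready Q E \<gamma> \<longleftrightarrow> fst \<gamma> \<in> Q \<and> pumpable E (scc E (fst \<gamma>)) \<and>
     card (scc E (fst \<gamma>)) < snd \<gamma> \<and> snd \<gamma> \<le> card Q + 1"

definition up :: "'q trans set \<Rightarrow> 'q config \<Rightarrow> int" where
  "up E \<gamma> = gain E (scc E (fst \<gamma>))"

definition down :: "'q trans set \<Rightarrow> 'q config \<Rightarrow> int" where
  "down E \<gamma> = gain (flip ` E) (scc E (fst \<gamma>))"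

text \<open>Nothing is required of the levels of the connecting walk, and its effect is fixed only
  modulo the gcd of the two gains; pumping repairs both.\<close>

definition jump :: "'q set \<Rightarrow> 'q trans set \<Rightarrow> 'q config \<Rightarrow> 'q config \<Rightarrow> bool" where
  "jump Q E \<gamma> \<gamma>' \<longleftrightarrow> ready Q E \<gamma> \<and> ready Q (flip ` E) \<gamma>' \<and>
     conn E (gcd (up E \<gamma>) (down E \<gamma>')) (fst \<gamma>) (int (snd \<gamma>') - int (snd \<gamma>)) (fst \<gamma>')"

text \<open>\<open>N\<close> is the set of nodes of the walk between the two cycles, at the levels they have after the
  upward cycle has been pumped \<open>x\<close> times; these levels are therefore consistent with \<open>\<gamma>\<close> modulo
  \<open>up E \<gamma>\<close> and with \<open>\<gamma>'\<close> modulo \<open>down E \<gamma>'\<close>.\<close>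

definition realised :: "'q set \<Rightarrow> 'q trans set \<Rightarrow> 'q config \<Rightarrow> 'q config \<Rightarrow>
    ('q \<times> int) set \<Rightarrow> 'q trans list \<Rightarrow> nat \<Rightarrow> nat \<Rightarrow> bool" where
  "realised Q E \<gamma> \<gamma>' N es x y \<longleftrightarrow>
     walk E (fst \<gamma>) es (fst \<gamma>') \<and> psafe (int (snd \<gamma>)) es \<and> int (snd \<gamma>) + eff es = int (snd \<gamma>') \<and>
     length es \<le> 2 * card Q + x * length (loop E (scc E (fst \<gamma>))) + card N
       + y * length (loop (flip ` E) (scc E (fst \<gamma>'))) \<and>
     int x * up E \<gamma> \<le> int (card N + 2 * card Q)
       + up E \<gamma> * (down E \<gamma>' div gcd (up E \<gamma>) (down E \<gamma>')) \<and>
     int y * down E \<gamma>' \<le> int (2 * card N + 2 * card Q)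
       + down E \<gamma>' * (up E \<gamma> div gcd (up E \<gamma>) (down E \<gamma>')) \<and>
     finite N \<and> N \<subseteq> Q \<times> UNIV \<and>
     (\<exists>z. (anchor E (scc E (fst \<gamma>)), z) \<in> N) \<and>
     (\<exists>z. (anchor (flip ` E) (scc E (fst \<gamma>')), z) \<in> N) \<and>
     (\<forall>s z. (s, z) \<in> N \<longrightarrow> conn E (up E \<gamma>) (fst \<gamma>) (z - int (snd \<gamma>)) s
        \<and> conn E (down E \<gamma>') s (int (snd \<gamma>') - z) (fst \<gamma>')) \<and>
     (\<forall>s z z'. (s, z) \<in> N \<longrightarrow> (s, z') \<in> N \<longrightarrow>
        [z = z'] (mod gcd (up E \<gamma>) (down E \<gamma>')) \<longrightarrow> z = z')"

section \<open>Realising a jump by a safe walk\<close>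

context unit_graph
begin

text \<open>The walk is a detour to the upward anchor, \<open>x\<close> upward cycles, a minimal
  walk \<open>W\<close> between the anchors, \<open>y\<close> downward cycles and a detour to the
  target. The upward cycles lift \<open>W\<close> above its own length, and the two counts together
  correct its effect.\<close>

lemma jump_realised:
  assumes "jump Q E \<gamma> \<gamma>'"
  shows "\<exists>N es x y. realised Q E \<gamma> \<gamma>' N es x y"
proof -
  interpret rev: unit_graph Q "flip ` E" by (rule flip_graph)
  obtain p c q d where \<gamma>: "\<gamma> = (p, c)" "\<gamma>' = (q, d)" by (metis surj_pair)
  define K K' where "K = scc E p" and "K' = scc E q"
  define a b where "a = gain E K" and "b = gain (flip ` E) K'"
  define g where "g = gcd a b"
  define u v where "u = anchor E K" and "v = anchor (flip ` E) K'"
  have J: "p \<in> Q" "pumpable E K" "card K < c" "c \<le> card Q + 1"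
    "q \<in> Q" "pumpable (flip ` E) K'" "card K' < d" "d \<le> card Q + 1"
    "conn E g p (int d - int c) q"
    using assms \<gamma> unfolding jump_def ready_def up_def down_def K_def K'_def g_def a_def b_def
    by (auto simp: scc_flip)
  note A = pumps_gain[OF J(2), folded a_def u_def]
  note B = rev.pumps_gain[OF J(6), folded b_def v_def]
  have g: "g > 0" using A(1) by (simp add: g_def)
  have cK: "card K \<le> card Q" "card K' \<le> card Q"
    using scc_sub_Q finite_Q J(1,5) by (simp_all add: K_def K'_def card_mono)
  have Ks: "scc E u = K" "scc E v = K'"
    using scc_eq[OF A(4)[unfolded K_def]] scc_eq[OF B(4)[unfolded K'_def]] by (simp_all add: K_def K'_def)
  have uv: "u \<in> Q" "v \<in> Q"
    using A(4) B(4) scc_sub_Q J(1,5) by (auto simp: K_def K'_def)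
  obtain \<pi> where \<pi>: "walk E p \<pi> u" "length \<pi> < card K"
    using short_walk[OF J(1), of u] A(4) by (auto simp: K_def)
  obtain \<rho> where \<rho>: "walk E v \<rho> q" "length \<rho> < card K'"
    using short_walk[OF uv(2), of q] Ks scc_refl[of q E] by (auto simp: K'_def)
  \<comment> \<open>The levels where upward pumping starts and where downward pumping ends. The
    detours are shorter than their components, which gives the bounds 1 and
    \<open>2 * card Q\<close>.\<close>
  define h h' where "h = int c + eff \<pi>" and "h' = int d - eff \<rho>"
  have h: "1 \<le> h" "h \<le> 2 * int (card Q)" "1 \<le> h'" "h' \<le> 2 * int (card Q)"
    using eff_bound[OF \<pi>(1)] eff_bound[OF \<rho>(1)] \<pi>(2) \<rho>(2) J(3,4,7,8) cK
    by (simp_all add: h_def h'_def)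
  obtain \<sigma> where "walk E u \<sigma> p"
    using A(4) unfolding K_def scc_def by auto
  then have 1: "conn E g u (- eff \<pi>) p"
    by (rule conn_back[OF conn_walk[OF \<pi>(1)] _ g])
  obtain \<tau> where "walk E q \<tau> v"
    using B(4) unfolding K'_def scc_def by auto
  then have 2: "conn E g q (- eff \<rho>) v"
    by (rule conn_back[OF conn_walk[OF \<rho>(1)] _ g])
  have "conn E g u (h' - h) v"
    using conn_trans[OF 1 conn_trans[OF J(9) 2]] by (simp add: h_def h'_def algebra_simps)
  then obtain W where W: "walk E u W v" "[eff W = h' - h] (mod g)"
    and min: "\<And>s t. s < t \<Longrightarrow> t \<le> length W \<Longrightarrow> tgt u (take s W) = tgt u (take t W) \<Longrightarrow>
      \<not> [eff (take s W) = eff (take t W)] (mod g)"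
    by (rule minimal_walk) blast
  define m where "m = length W"
  have eW: "\<bar>eff W\<bar> \<le> int m" using eff_bound[OF W(1)] by (simp add: m_def)
  \<comment> \<open>\<open>D\<close> is the effect that the cycles must contribute. In
    \<open>T\<close>, the summand \<open>m\<close> keeps \<open>W\<close> positive and the maximum
    ensures \<open>T \<ge> 0\<close> and \<open>T \<ge> D\<close>.\<close>
  define D where "D = h' - h - eff W"
  define T where "T = int m + max 0 (h' - h)"
  have gD: "gcd a b dvd D" using W(2) by (simp add: D_def g_def cong_iff_dvd_diff dvd_diff_commute)
  have T0: "T \<ge> 0" and TD: "T \<ge> D" using eW by (auto simp: T_def D_def)
  obtain x y :: nat where xy: "int x * a = D + int y * b" "T \<le> int x * a"
    "int x * a < T + a * (b div gcd a b)"
    using pump_counts[OF A(1) B(1) gD T0 TD] by blast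
  obtain X where X: "walk E u X u" "eff X = int x * a" "\<And>c. c \<ge> 1 \<Longrightarrow> psafe c X"
    "length X = x * length (loop E K)"
    using pump_run[OF J(2), of x, folded a_def u_def] by metis
  obtain Y where Y: "walk (flip ` E) v Y v" "eff Y = int y * b" "\<And>c. c \<ge> 1 \<Longrightarrow> psafe c Y"
    "length Y = y * length (loop (flip ` E) K')"
    using rev.pump_run[OF J(6), of y, folded b_def v_def] by metis
  define es where "es = \<pi> @ X @ W @ rwalk Y @ \<rho>"
  have walk_Y: "walk E v (rwalk Y) v" using walk_rwalk[OF Y(1)] by simp
  have walk_es: "walk E p es q"
    unfolding es_def by (intro walk_appendI[OF \<pi>(1)] walk_appendI[OF X(1)] walk_appendI[OF W(1)]
      walk_appendI[OF walk_Y] \<rho>(1))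
  have lev: "h + int x * a + eff W = h' + int y * b" using xy(1) by (simp add: D_def)
  have safe_es: "psafe (int c) es"
  proof -
    have "psafe (int c) \<pi>" using psafe_high[OF \<pi>(1)] \<pi>(2) J(3) by simp
    moreover have "psafe h X" using X(3) h(1) .
    moreover have "psafe (h + int x * a) W"
      using psafe_high[OF W(1)] h(1) xy(2) by (simp add: T_def m_def)
    moreover have "psafe (h' + int y * b) (rwalk Y)"
      using psafe_rwalk[OF Y(3)[OF h(3)]] Y(2) by simp
    moreover have "psafe h' \<rho>"
      using psafe_high_end[OF \<rho>(1)] \<rho>(2) J(7) by (simp add: h'_def)
    ultimately show ?thesis
      using lev by (simp add: es_def psafe_append X(2) Y(2) flip: h_def)
  qed
  have eff_es: "int c + eff es = int d"
    using lev by (simp add: es_def X(2) Y(2) h_def h'_def)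
  define \<nu> where "\<nu> t = (tgt u (take t W), h + int x * a + eff (take t W))" for t
  define N where "N = \<nu> ` {..m}"
  \<comment> \<open>Minimality of \<open>W\<close> separates its nodes modulo \<open>g\<close>;
    hence \<open>N\<close> has exactly \<open>m + 1\<close> elements.\<close>
  have inj: "s = t" if "s \<le> m" "t \<le> m" "fst (\<nu> s) = fst (\<nu> t)" "[snd (\<nu> s) = snd (\<nu> t)] (mod g)" for s t
  proof (rule ccontr)
    have "[eff (take s W) = eff (take t W)] (mod g)"
      using that(4) cong_add_lcancel unfolding \<nu>_def by auto
    moreover assume "s \<noteq> t"
    ultimately show False
      using that(1-3) min[of s t] min[of t s] by (auto simp: \<nu>_def m_def neq_iff cong_sym_eq)
  qed
  have "inj_on \<nu> {..m}" by (intro inj_onI) (simp add: inj)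
  then have cN: "card N = m + 1" by (simp add: N_def card_image)
  have N1: "finite N" "N \<subseteq> Q \<times> UNIV"
    using walk_in_Q[OF walk_take[OF W(1)] uv(1)] by (auto simp: N_def \<nu>_def)
  have N2: "\<exists>z. (u, z) \<in> N"
    by (rule exI[of _ "snd (\<nu> 0)"]) (auto simp: N_def \<nu>_def intro!: image_eqI[of _ _ 0])
  have N3: "\<exists>z. (v, z) \<in> N"
    using walk_tgt[OF W(1)]
    by (intro exI[of _ "snd (\<nu> m)"]) (auto simp: N_def \<nu>_def m_def intro!: image_eqI[of _ _ m])
  have N4: "conn E a p (z - int c) s \<and> conn E b s (int d - z) q" if "(s, z) \<in> N" for s z
  proof -
    obtain t where t: "t \<le> m" "s = tgt u (take t W)" "z = h + int x * a + eff (take t W)"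
      using \<open>(s, z) \<in> N\<close> by (auto simp: N_def \<nu>_def)
    have "conn E a p (eff (\<pi> @ take t W)) s"
      using conn_walk[OF walk_appendI[OF \<pi>(1) walk_take[OF W(1)]]] t(2) by simp
    moreover have "[eff (\<pi> @ take t W) = z - int c] (mod a)"
      by (simp add: t(3) h_def cong_iff_dvd_diff)
    moreover have "conn E b s (eff (drop t W @ \<rho>)) q"
      using conn_walk[OF walk_appendI[OF walk_drop[OF W(1)] \<rho>(1)]] t(2) by simp
    moreover have "eff (drop t W @ \<rho>) - (int d - z) = int y * b"
      using lev by (simp add: t(3) h'_def eff_drop)
    then have "[eff (drop t W @ \<rho>) = int d - z] (mod b)"
      by (simp add: cong_iff_dvd_diff)
    ultimately show ?thesis by (intro conjI; elim conn_cong)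
  qed
  have N5: "z = z'" if N: "(s, z) \<in> N" "(s, z') \<in> N" "[z = z'] (mod g)" for s z z'
  proof -
    obtain i j where "i \<le> m" "j \<le> m" "\<nu> i = (s, z)" "\<nu> j = (s, z')"
      using N(1,2) by (auto simp: N_def)
    with inj[of i j] N(3) show ?thesis by auto
  qed
  have len: "length es \<le> 2 * card Q + x * length (loop E K) + card N + y * length (loop (flip ` E) K')"
    using \<pi>(2) \<rho>(2) cK cN by (simp add: es_def X(4) Y(4) m_def)
  have x: "int x * a \<le> int (card N + 2 * card Q) + a * (b div g)"
    using xy(3) h cN by (simp add: T_def g_def)
  \<comment> \<open>\<open>card N\<close> is counted twice here: once through \<open>m\<close> in
    \<open>T\<close>, once through the effect of \<open>W\<close> in \<open>D\<close>.\<close>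
  have "int y * b = int x * a - D" using xy(1) by simp
  then have y: "int y * b \<le> int (2 * card N + 2 * card Q) + a * (b div g)"
    using xy(3) h cN eW by (simp add: T_def D_def g_def)
  have "a * (b div g) = b * (a div g)"
    unfolding g_def by (metis div_mult_swap dvd_div_mult gcd_dvd1 gcd_dvd2 mult.commute)
  then have "realised Q E \<gamma> \<gamma>' N es x y"
    unfolding realised_def up_def down_def \<gamma>
    using walk_es safe_es eff_es len x y N1 N2 N3 N4 N5
    by (simp flip: K_def K'_def a_def b_def g_def u_def v_def)
  then show ?thesis by blast
qed

section \<open>Cutting high excursions at ready configurations\<close>

lemma eff_take_Suc:
  assumes "walk E p es q" "s < length es"
  shows "eff (take (Suc s) es) \<le> eff (take s es) + 1"
proof -
  have "eff (drop s (take (Suc s) es)) \<le> 1"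
    using eff_bound[OF walk_mid[OF assms(1), of s "Suc s"]] assms(2) by simp
  then show ?thesis by (simp add: eff_drop min_def)
qed

text \<open>The first visits of the levels \<open>1, \<dots>, card Q + 1\<close> are distributed over the strongly
  connected components, so some component \<open>K\<close> receives more than \<open>card K\<close> of them.\<close>

lemma ascent:
  assumes "p \<in> Q" "walk E p es q" "j \<le> length es" "1 + eff (take j es) > int (card Q)"
  obtains t c where "t \<le> j" "1 + eff (take t es) = int c" "ready Q E (tgt p (take t es), c)"
    "\<And>s. s \<le> t \<Longrightarrow> eff (take s es) \<le> int (card Q)"
proof -
  define h where "h s = 1 + eff (take s es)" for s
  define \<tau> where "\<tau> l = (LEAST s. h s \<ge> int l)" for l :: nat
  define x where "x l = tgt p (take (\<tau> l) es)" for l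
  let ?L = "{1..card Q + 1}"
  have ge: "h (\<tau> l) \<ge> int l" and le_j: "\<tau> l \<le> j" if "l \<in> ?L" for l
  proof -
    have *: "h j \<ge> int l" using assms(4) that by (simp add: h_def)
    show "h (\<tau> l) \<ge> int l" unfolding \<tau>_def by (rule LeastI[of _ j]) (rule *)
    show "\<tau> l \<le> j" unfolding \<tau>_def by (rule Least_le) (rule *)
  qed
  have lt: "h s < int l" if "s < \<tau> l" for s l
    using not_less_Least[OF that[unfolded \<tau>_def]] by simp
  \<comment> \<open>Levels rise by at most one per edge, so the first time at or above
    \<open>l\<close> is a time exactly at \<open>l\<close>.\<close>
  have eq: "h (\<tau> l) = int l" if l: "l \<in> ?L" for l
  proof (cases "\<tau> l")
    case 0
    then show ?thesis using ge[OF l] l by (simp add: h_def)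
  next
    case (Suc s)
    then have "h (\<tau> l) \<le> h s + 1"
      using eff_take_Suc[OF assms(2), of s] le_j[OF l] assms(3) by (simp add: h_def)
    then show ?thesis using ge[OF l] lt[of s l] Suc by simp
  qed
  have mono: "\<tau> l < \<tau> l'" if "l \<in> ?L" "l' \<in> ?L" "l < l'" for l l'
    using eq[OF that(1)] eq[OF that(2)] lt[of "\<tau> l'" l] that(3) by (metis linorder_neqE_nat
      less_imp_of_nat_less less_irrefl order.strict_trans)
  have x_Q: "x l \<in> Q" for l
    using walk_in_Q[OF walk_take[OF assms(2)] assms(1)] by (simp add: x_def)
  let ?F = "\<lambda>K. {l \<in> ?L. scc E (x l) = K}"
  obtain K where K: "card (?F K) > card K"
  proof (rule ccontr)
    assume "\<not> thesis"
    then have "card (?F K) \<le> card K" for K using that by (meson not_le)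
    then have "(\<Sum>K\<in>(\<lambda>l. scc E (x l)) ` ?L. card (?F K)) \<le> (\<Sum>K\<in>(\<lambda>l. scc E (x l)) ` ?L. card K)"
      by (intro sum_mono)
    also have "\<dots> \<le> card Q" using x_Q by (intro sum_card_scc) auto
    finally show False
      using sum.image_gen[of ?L "\<lambda>_. 1 :: nat" "\<lambda>l. scc E (x l)"] by simp
  qed
  then have ne: "?F K \<noteq> {}" by (metis card.empty not_less0)
  \<comment> \<open>The highest of more than \<open>card K\<close> distinct positive levels exceeds
    \<open>card K\<close>.\<close>
  define c where "c = Max (?F K)"
  have c: "c \<in> ?L" "scc E (x c) = K" using Max_in[OF _ ne] by (auto simp: c_def)
  have "?F K \<subseteq> {1..c}" by (auto simp: c_def)
  then have "card (?F K) \<le> c" using card_mono[of "{1..c}" "?F K"] by simp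
  with K have c_gt: "card K < c" by simp
  have finK: "finite K" using c(2) finite_scc[OF x_Q] by blast
  have "x ` ?F K \<subseteq> K" using scc_refl by auto
  \<comment> \<open>Two of these visits share a node; the segment between them is closed and its
    effect is the positive difference of the levels.\<close>
  then have "\<not> inj_on x (?F K)" using card_inj_on_le[OF _ _ finK] K by (meson not_le)
  then have "\<not> (\<forall>k l. k < l \<longrightarrow> k \<in> ?F K \<longrightarrow> l \<in> ?F K \<longrightarrow> x k \<noteq> x l)"
    using linorder_inj_onI[of "?F K" x] nle_le by blast
  then obtain k l where kl: "k \<in> ?F K" "l \<in> ?F K" "k < l" "x k = x l"
    by blast
  have \<tau>: "\<tau> k < \<tau> l" using mono kl by blast
  have "walk E (x k) (drop (\<tau> k) (take (\<tau> l) es)) (x k)"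
    using walk_mid[OF assms(2), of "\<tau> k" "\<tau> l"] \<tau> kl(4) by (simp add: x_def)
  moreover have "eff (drop (\<tau> k) (take (\<tau> l) es)) > 0"
    using \<tau> eq[of k] eq[of l] kl by (simp add: eff_drop min_def h_def)
  ultimately have "pumpable E K"
    using positive_loop[OF x_Q scc_refl, of k] kl(1) by auto
  then have "ready Q E (x c, c)"
    using x_Q c c_gt by (simp add: ready_def)
  moreover have "eff (take s es) \<le> int (card Q)" if "s \<le> \<tau> c" for s
    using that lt[of s c] eq[of c] c(1) by (cases "s = \<tau> c") (auto simp: h_def)
  ultimately show ?thesis
    using that[of "\<tau> c" c] le_j[OF c(1)] eq[OF c(1)] by (simp add: h_def x_def)
qed

text \<open>\<open>ascent\<close> finds the start of the jump on the way up and, applied to the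
  reversed remainder, its end on the way down. Only the effect of the middle part is
  retained.\<close>

lemma peak_jump:
  assumes "p \<in> Q" "walk E p es q" "eff es = 0" "j \<le> length es" "1 + eff (take j es) > int (card Q)"
  obtains es1 es2 es3 x c y d where "es = es1 @ es2 @ es3"
    "walk E p es1 x" "1 + eff es1 = int c" "\<And>s. s \<le> length es1 \<Longrightarrow> eff (take s es1) \<le> int (card Q)"
    "jump Q E (x, c) (y, d)"
    "walk E y es3 q" "int d + eff es3 = 1" "\<And>s. int d + eff (take s es3) \<le> int (card Q) + 1"
proof -
  interpret rev: unit_graph Q "flip ` E" by (rule flip_graph)
  obtain t c where t: "t \<le> j" "1 + eff (take t es) = int c" "ready Q E (tgt p (take t es), c)"
    "\<And>s. s \<le> t \<Longrightarrow> eff (take s es) \<le> int (card Q)"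
    using ascent[OF assms(1,2,4,5)] by blast
  define fs where "fs = rwalk (drop t es)"
  let ?x = "tgt p (take t es)"
  have "walk E ?x (drop t es) q" by (rule walk_drop[OF assms(2)])
  then have w: "walk (flip ` E) q fs ?x" unfolding fs_def by (rule walk_rwalk)
  have q: "q \<in> Q" using walk_in_Q assms(1,2) by blast
  have take_fs: "take s fs = rwalk (drop (length es - s) es)" if "s \<le> length es - t" for s
    using that t(1) assms(4) by (simp add: fs_def rwalk_def take_rev drop_map)
  \<comment> \<open>Since \<open>es\<close> has effect 0, the reversed walk meets the peak at the
    same level.\<close>
  have "eff (take (length es - j) fs) = eff (take j es)"
    using take_fs[of "length es - j"] t(1) assms(3,4) by (simp add: eff_drop)
  then have "1 + eff (take (length es - j) fs) > int (card Q)" using assms(5) by simp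
  then obtain t' d where t': "t' \<le> length es - j" "1 + eff (take t' fs) = int d"
    "ready Q (flip ` E) (tgt q (take t' fs), d)"
    "\<And>s. s \<le> t' \<Longrightarrow> eff (take s fs) \<le> int (card Q)"
    using t(1) by (elim rev.ascent[OF q w, of "length es - j", rotated]) (auto simp: fs_def)
  define es2 es3 where "es2 = rwalk (drop t' fs)" and "es3 = rwalk (take t' fs)"
  let ?y = "tgt q (take t' fs)"
  have es: "es = take t es @ es2 @ es3"
    by (simp add: es2_def es3_def fs_def flip: rwalk_append)
  have w3: "walk E ?y es3 q" using walk_rwalk[OF walk_take[OF w]] by (simp add: es3_def)
  have w2: "walk E ?x es2 ?y" using walk_rwalk[OF walk_drop[OF w]] by (simp add: es2_def)
  have e3: "int d + eff es3 = 1" using t'(2) by (simp add: es3_def)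
  have "eff (take t es) + eff es2 + eff es3 = 0"
    using assms(3) arg_cong[OF es, of eff] by simp
  then have "eff es2 = int d - int c" using e3 t(2) by simp
  then have "jump Q E (?x, c) (?y, d)"
    using t(3) t'(3) conn_walk[OF w2] by (simp add: jump_def)
  moreover have "int d + eff (take s es3) \<le> int (card Q) + 1" for s
  proof -
    have "take s es3 = rwalk (drop (length (take t' fs) - s) (take t' fs))"
      by (simp add: es3_def rwalk_def take_rev drop_map)
    then have "int d + eff (take s es3) = 1 + eff (take (length (take t' fs) - s) (take t' fs))"
      using t'(2) by (simp add: eff_drop)
    also have "\<dots> \<le> int (card Q) + 1"
      using t'(4)[of "min (length (take t' fs) - s) t'"] by (simp add: min.commute)
    finally show ?thesis .
  qed
  ultimately show ?thesis
    using that[of "take t es" es2 es3 ?x c ?y d, OF es walk_take[OF assms(2)] t(2) _ _ w3 e3] t(4)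
    by (simp add: min_def)
qed

end

section \<open>One-counter systems\<close>

lemma is_path_append: "is_path S \<alpha> \<pi> \<beta> \<Longrightarrow> is_path S \<beta> \<rho> \<gamma> \<Longrightarrow> is_path S \<alpha> (\<pi> @ \<rho>) \<gamma>"
  by (induction S \<alpha> \<pi> \<beta> rule: is_path.induct) auto

lemma step_pos:
  assumes "(p, e, s) \<in> tpos S" "c \<ge> 1" "int c + e \<ge> 0"
  shows "step S (p, c) (p, e, s) (s, nat (int c + e))"
  using assms by (simp add: step_def)

lemma run_is_path:
  assumes "walk (tpos S) p es q" "psafe (int c) es"
  shows "\<exists>\<pi>. is_path S (p, c) \<pi> (q, nat (int c + eff es)) \<and> length \<pi> = length es"
  using assms
proof (induction es arbitrary: p c)
  case Nil
  then show ?case by (auto intro: exI[of _ "[]"])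
next
  case (Cons t es)
  obtain r e s where t: "t = (r, e, s)" by (cases t)
  have *: "(p, e, s) \<in> tpos S" "walk (tpos S) s es q" "c \<ge> 1" "psafe (int c + e) es" "r = p"
    using Cons.prems t by auto
  from psafe_start[OF *(4)] have ge: "int c + e \<ge> 1" .
  obtain \<pi> where "is_path S (s, nat (int c + e)) \<pi> (q, nat (int c + e + eff es))" "length \<pi> = length es"
    using Cons.IH[OF *(2), of "nat (int c + e)"] *(4) ge by auto
  then show ?case
    using step_pos[OF *(1,3)] ge t *(5) by (intro exI[of _ "((p, c), t) # \<pi>"]) (auto simp: add.assoc)
qed

text \<open>The bound is \<open>n + 1\<close>, for \<open>n\<close> states, because
  \<open>ascent\<close> needs the \<open>n + 1\<close> levels from 1 to \<open>n + 1\<close> for its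
  pigeonhole argument.\<close>

definition low_step :: "'q ocs \<Rightarrow> ('q config \<times> 'q config) set" where
  "low_step S = {(\<gamma>, \<gamma>'). \<gamma> \<in> states S \<times> {..card (states S) + 1} \<and>
     \<gamma>' \<in> states S \<times> {..card (states S) + 1} \<and> (\<exists>t. step S \<gamma> t \<gamma>')}"

definition low_move :: "'q ocs \<Rightarrow> ('q config \<times> 'q config) set" where
  "low_move S = low_step S \<union> {(\<gamma>, \<gamma>'). jump (states S) (tpos S) \<gamma> \<gamma>'}"

lemma low_moveI:
  assumes "step S (p, c) t (q, d)" "p \<in> states S" "q \<in> states S"
    "c \<le> card (states S) + 1" "d \<le> card (states S) + 1"
  shows "((p, c), (q, d)) \<in> low_move S"
proof -
  have "\<exists>t. step S (p, c) t (q, d)" using assms(1) by blast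
  with assms(2-) show ?thesis by (simp add: low_move_def low_step_def)
qed

locale one_counter =
  fixes S :: "'q ocs"
  assumes wf: "wf_ocs S"
begin

sublocale unit_graph "states S" "tpos S"
  using wf by unfold_locales (auto simp: wf_ocs_def)

lemma low_run:
  assumes "walk (tpos S) p es q" "psafe (int c) es" "p \<in> states S"
    "\<And>s. s \<le> length es \<Longrightarrow> int c + eff (take s es) \<le> int (card (states S)) + 1"
  shows "((p, c), (q, nat (int c + eff es))) \<in> (low_move S)\<^sup>*"
  using assms
proof (induction es arbitrary: p c)
  case (Cons t es)
  obtain r e s where t: "t = (r, e, s)" by (cases t)
  have *: "(p, e, s) \<in> tpos S" "walk (tpos S) s es q" "c \<ge> 1" "psafe (int c + e) es"
    using Cons.prems t by auto
  from psafe_start[OF *(4)] have ge: "int c + e \<ge> 1" .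
  have s: "s \<in> states S" using *(1) E_sub by auto
  have "int c \<le> int (card (states S)) + 1" using Cons.prems(4)[of 0] by simp
  moreover have "int c + e \<le> int (card (states S)) + 1" using Cons.prems(4)[of 1] t by simp
  ultimately have "((p, c), (s, nat (int c + e))) \<in> low_move S"
    using ge Cons.prems(3) s by (intro low_moveI[OF step_pos[OF *(1,3)]]) auto
  moreover have "((s, nat (int c + e)), (q, nat (int c + e + eff es))) \<in> (low_move S)\<^sup>*"
    using Cons.IH[OF *(2) _ s, of "nat (int c + e)"] *(4) ge Cons.prems(4)[of "Suc _"] t
    by (auto simp: add.assoc)
  ultimately show ?case using t by (auto simp: add.assoc intro: converse_rtrancl_into_rtrancl)
qed auto

text \<open>If the arc exceeds level \<open>n + 1\<close>, for \<open>n\<close> states,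
  \<open>peak_jump\<close> replaces its middle by one jump and leaves two low ends.\<close>

lemma arc_low:
  assumes "walk (tpos S) p es q" "psafe 1 es" "eff es = 0" "p \<in> states S"
  shows "((p, 1), (q, 1)) \<in> (low_move S)\<^sup>*"
proof (cases "\<forall>j \<le> length es. 1 + eff (take j es) \<le> int (card (states S)) + 1")
  case True
  then show ?thesis using low_run[of p es q 1] assms by auto
next
  case False
  then obtain j where "j \<le> length es" "1 + eff (take j es) > int (card (states S))" by force
  then obtain es1 es2 es3 x c y d where es: "es = es1 @ es2 @ es3"
    and 1: "walk (tpos S) p es1 x" "1 + eff es1 = int c"
      "\<And>s. s \<le> length es1 \<Longrightarrow> eff (take s es1) \<le> int (card (states S))"
    and J: "jump (states S) (tpos S) (x, c) (y, d)"
    and 3: "walk (tpos S) y es3 q" "int d + eff es3 = 1"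
      "\<And>s. int d + eff (take s es3) \<le> int (card (states S)) + 1"
    using peak_jump[OF assms(4,1,3)] by metis
  have "((p, 1), (x, c)) \<in> (low_move S)\<^sup>*"
    using low_run[OF 1(1), of 1] assms(2,4) 1(2,3) by (simp add: es psafe_append)
  also have "((x, c), (y, d)) \<in> low_move S"
    using J by (simp add: low_move_def)
  also have "((y, d), (q, 1)) \<in> (low_move S)\<^sup>*"
  proof -
    have "int d = 1 + eff es1 + eff es2" using assms(3) 3(2) by (simp add: es)
    then have "psafe (int d) es3" using assms(2) by (simp add: es psafe_append add.assoc)
    moreover have "y \<in> states S" using J by (simp add: jump_def ready_def)
    ultimately show ?thesis using low_run[OF 3(1), of d] 3(2,3) by simp
  qed
  finally show ?thesis .
qed

text \<open>The path is cut at its visits of counter value 0. Each arc between two such visits is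
  collected until the counter returns to 0 and is then converted by \<open>arc_low\<close>.\<close>

lemma reachable_low_move:
  assumes "is_path S (p, 0) \<pi> (q, 0)" "p \<in> states S"
  shows "((p, 0), (q, 0)) \<in> (low_move S)\<^sup>*"
proof -
  \<comment> \<open>At a positive counter value the invariant keeps the unfinished arc
    \<open>es\<close>, which starts at level 1.\<close>
  let ?I = "\<lambda>\<gamma>. fst \<gamma> \<in> states S \<and> (if snd \<gamma> = 0 then ((p, 0), \<gamma>) \<in> (low_move S)\<^sup>* else
    (\<exists>s es. s \<in> states S \<and> ((p, 0), (s, 1)) \<in> (low_move S)\<^sup>* \<and> walk (tpos S) s es (fst \<gamma>) \<and>
       psafe 1 es \<and> 1 + eff es = int (snd \<gamma>)))"
  have inv: "?I \<gamma>'" if I: "?I \<gamma>" and st: "step S \<gamma> t \<gamma>'" for \<gamma> t \<gamma>'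
  proof -
    obtain x c where \<gamma>: "\<gamma> = (x, c)" by (cases \<gamma>)
    obtain e y where t: "t = (x, e, y)" using st \<gamma> by (cases t) (auto simp: step_def)
    have \<gamma>': "\<gamma>' = (y, nat (int c + e))" "int c + e \<ge> 0" using st \<gamma> t by (auto simp: step_def)
    have e: "e \<in> {-1, 0, 1}" "y \<in> states S" "x \<in> states S"
      using st t wf by (auto simp: step_def wf_ocs_def)
    show ?thesis
    proof (cases "c = 0")
      case True
      have "card (states S) > 0" using e(2) finite_Q by (auto simp: card_gt_0_iff)
      then have "(\<gamma>, \<gamma>') \<in> low_move S"
        using st e \<gamma> \<gamma>' True by (auto intro!: low_moveI[of _ _ _ t])
      then have *: "((p, 0), \<gamma>') \<in> (low_move S)\<^sup>*" using I \<gamma> True by auto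
      show ?thesis
      proof (cases "e = 1")
        case True
        then show ?thesis using * \<gamma>' e \<open>c = 0\<close> by (auto intro!: exI[of _ y] exI[of _ "[]"])
      next
        case False
        then show ?thesis using * \<gamma>' e \<open>c = 0\<close> by auto
      qed
    next
      case False
      obtain s es where es: "s \<in> states S" "((p, 0), (s, 1)) \<in> (low_move S)\<^sup>*"
        "walk (tpos S) s es x" "psafe 1 es" "1 + eff es = int c"
        using I \<gamma> False by auto
      have tp: "(x, e, y) \<in> tpos S" using st \<gamma> t False by (auto simp: step_def)
      show ?thesis
      proof (cases "int c + e = 0")
        case True
        \<comment> \<open>Zero is entered only from level 1, so the finished arc has effect
          0.\<close>
        then have "c = 1" "e = -1" using e False by auto
        then have "((s, 1), (x, 1)) \<in> (low_move S)\<^sup>*" using arc_low[OF es(3,4)] es by simp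
        moreover have "((x, 1), (y, 0)) \<in> low_move S"
          using st e \<gamma> \<gamma>' \<open>c = 1\<close> \<open>e = -1\<close> by (auto intro!: low_moveI[of _ _ _ t])
        ultimately show ?thesis using es(2) e \<gamma>' True by auto
      next
        case nz: False
        have "walk (tpos S) s (es @ [(x, e, y)]) y" using walk_appendI[OF es(3)] tp by simp
        moreover have "psafe 1 (es @ [(x, e, y)])"
          using es(4,5) False nz \<gamma>'(2) by (simp add: psafe_append)
        moreover have "1 + eff (es @ [(x, e, y)]) = int (snd \<gamma>')"
          using es(5) \<gamma>' by simp
        moreover have "fst \<gamma>' = y" "snd \<gamma>' \<noteq> 0" using \<gamma>' nz by auto
        ultimately show ?thesis using es(1,2) e(2)
          by (simp del: eff_append) (intro exI[of _ s] conjI exI[of _ "es @ [(x, e, y)]"]; simp)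
      qed
    qed
  qed
  have "?I \<gamma>'" if "?I \<gamma>" "is_path S \<gamma> \<pi> \<gamma>'" for \<gamma> \<gamma>'
    using that
  proof (induction \<pi> arbitrary: \<gamma>)
    case (Cons e \<pi>)
    obtain t \<delta> where "step S \<gamma> t \<delta>" "is_path S \<delta> \<pi> \<gamma>'"
      using Cons.prems(2) by (cases e) auto
    then show ?case using Cons.IH inv[OF Cons.prems(1)] by blast
  next
    case Nil
    then have "\<gamma> = \<gamma>'" by simp
    then show ?case using Nil.prems(1) by (rule subst)
  qed
  from this[of "(p, 0)" "(q, 0)"] show ?thesis using assms by simp
qed

end

section \<open>Counting\<close>

text \<open>Here \<open>C\<close> and \<open>D\<close> give the components of a jump,
  \<open>a\<close> and \<open>b\<close> the gains, \<open>\<alpha>\<close> the cycle lengths and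
  \<open>x\<close> the numbers of repetitions. For one \<open>\<kappa>\<close>, the multiplicity of
  each pair cancels the denominator \<open>gcd (a \<kappa>) (b l)\<close>, so at most
  \<open>W + n\<close> repetitions occur.\<close>

lemma pump_cost:
  fixes a \<alpha> :: "'k \<Rightarrow> int" and b :: "'l \<Rightarrow> int" and x w :: "'i \<Rightarrow> int"
  assumes "finite I"
    and pos: "\<And>\<kappa>. \<kappa> \<in> C ` I \<Longrightarrow> a \<kappa> > 0" "\<And>\<kappa>. \<kappa> \<in> C ` I \<Longrightarrow> \<alpha> \<kappa> \<ge> 0" "\<And>l. l \<in> D ` I \<Longrightarrow> b l > 0" "W \<ge> 0" "n \<ge> 0"
    and x: "\<And>i. i \<in> I \<Longrightarrow> x i * a (C i) \<le> w i + a (C i) * (b (D i) div gcd (a (C i)) (b (D i)))"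
    and w: "\<And>\<kappa>. \<kappa> \<in> C ` I \<Longrightarrow> (\<Sum>i | i \<in> I \<and> C i = \<kappa>. w i) \<le> W * a \<kappa>"
    and pair: "\<And>\<kappa> l. \<kappa> \<in> C ` I \<Longrightarrow> l \<in> D ` I \<Longrightarrow>
      int (card {i \<in> I. C i = \<kappa> \<and> D i = l}) \<le> gcd (a \<kappa>) (b l)"
    and "(\<Sum>\<kappa>\<in>C ` I. \<alpha> \<kappa>) \<le> n" "(\<Sum>l\<in>D ` I. b l) \<le> n"
  shows "(\<Sum>i\<in>I. x i * \<alpha> (C i)) \<le> (W + n) * n"
proof -
  have fibre: "(\<Sum>i | i \<in> I \<and> C i = \<kappa>. x i) \<le> W + n" if \<kappa>: "\<kappa> \<in> C ` I" for \<kappa>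
  proof -
    let ?J = "{i \<in> I. C i = \<kappa>}"
    let ?q = "\<lambda>l. b l div gcd (a \<kappa>) (b l)"
    have "(\<Sum>i\<in>?J. ?q (D i)) = (\<Sum>l\<in>D ` I. \<Sum>i | i \<in> ?J \<and> D i = l. ?q (D i))"
      using assms(1) by (intro sum.group[symmetric]) auto
    also have "\<dots> = (\<Sum>l\<in>D ` I. int (card {i \<in> I. C i = \<kappa> \<and> D i = l}) * ?q l)"
      by (intro sum.cong refl) (simp add: conj_assoc)
    \<comment> \<open>Each summand becomes \<open>b l\<close>, and these add up to at most
      \<open>n\<close>.\<close>
    also have "\<dots> \<le> (\<Sum>l\<in>D ` I. gcd (a \<kappa>) (b l) * ?q l)"
    proof (intro sum_mono mult_right_mono pair[OF \<kappa>])
      fix l assume "l \<in> D ` I"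
      then show "?q l \<ge> 0"
        using pos(1)[OF \<kappa>] pos(3)[of l] by (simp add: pos_imp_zdiv_nonneg_iff gcd_pos_int)
    qed
    also have "\<dots> \<le> n" using assms(11) by simp
    finally have q: "(\<Sum>i\<in>?J. ?q (D i)) \<le> n" .
    have "(\<Sum>i\<in>?J. x i) * a \<kappa> \<le> (\<Sum>i\<in>?J. w i + a \<kappa> * ?q (D i))"
      unfolding sum_distrib_right using x by (intro sum_mono) auto
    also have "\<dots> = (\<Sum>i\<in>?J. w i) + a \<kappa> * (\<Sum>i\<in>?J. ?q (D i))"
      by (simp add: sum.distrib sum_distrib_left)
    also have "\<dots> \<le> W * a \<kappa> + a \<kappa> * n"
      using w[OF \<kappa>] q pos(1)[OF \<kappa>] by (intro add_mono mult_left_mono) auto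
    finally have "(\<Sum>i\<in>?J. x i) * a \<kappa> \<le> (W + n) * a \<kappa>" by (simp add: algebra_simps)
    then show ?thesis using pos(1)[OF \<kappa>] by simp
  qed
  have "(\<Sum>i\<in>I. x i * \<alpha> (C i)) = (\<Sum>\<kappa>\<in>C ` I. \<Sum>i | i \<in> I \<and> C i = \<kappa>. x i * \<alpha> (C i))"
    using assms(1) by (intro sum.group[symmetric]) auto
  also have "\<dots> = (\<Sum>\<kappa>\<in>C ` I. (\<Sum>i | i \<in> I \<and> C i = \<kappa>. x i) * \<alpha> \<kappa>)"
    by (intro sum.cong refl) (simp add: sum_distrib_right)
  also have "\<dots> \<le> (\<Sum>\<kappa>\<in>C ` I. (W + n) * \<alpha> \<kappa>)"
    using fibre pos(2) by (intro sum_mono mult_right_mono) auto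
  also have "\<dots> \<le> (W + n) * n"
    unfolding sum_distrib_left[symmetric] using assms(10) pos(4,5) by (intro mult_left_mono) auto
  finally show ?thesis .
qed

text \<open>The map to pairs of a state and a residue modulo \<open>m\<close> is injective on the
  disjoint union of the sets.\<close>

lemma card_separated:
  fixes N :: "'i \<Rightarrow> ('a \<times> int) set"
  assumes "finite J" "finite Q" "m > 0"
    and N: "\<And>i. i \<in> J \<Longrightarrow> finite (N i)" "\<And>i. i \<in> J \<Longrightarrow> N i \<subseteq> Q \<times> UNIV"
    and sep: "\<And>i j s z z'. i \<in> J \<Longrightarrow> j \<in> J \<Longrightarrow> (s, z) \<in> N i \<Longrightarrow> (s, z') \<in> N j \<Longrightarrow>
      [z = z'] (mod m) \<Longrightarrow> i = j \<and> z = z'"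
  shows "int (\<Sum>i\<in>J. card (N i)) \<le> int (card Q) * m"
proof -
  let ?f = "\<lambda>(i, s, z). (s, z mod m)"
  have "inj_on ?f (Sigma J N)"
    by (rule inj_onI) (use sep in \<open>auto simp: cong_def\<close>)
  moreover have "?f ` Sigma J N \<subseteq> Q \<times> {0..<m}"
    using N(2) assms(3) by auto
  ultimately have "card (Sigma J N) \<le> card (Q \<times> {0..<m})"
    using assms(2) by (intro card_inj_on_le) auto
  then have "(\<Sum>i\<in>J. card (N i)) \<le> card Q * nat m"
    using assms(1) N(1) by (simp add: card_cartesian_product)
  then have "int (\<Sum>i\<in>J. card (N i)) \<le> int (card Q * nat m)" by (rule of_nat_mono)
  then show ?thesis using assms(3) by simp
qed

section \<open>Total cost of the jumps and the final path\<close>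

context one_counter
begin

lemma low_move_nodes:
  assumes "(\<gamma>, \<gamma>') \<in> low_move S"
  shows "\<gamma> \<in> states S \<times> {..card (states S) + 1}" "\<gamma>' \<in> states S \<times> {..card (states S) + 1}"
  using assms by (auto simp: low_move_def low_step_def jump_def ready_def mem_Times_iff)

text \<open>Absence of shortcut jumps separates the walks: at a common node with congruent levels,
  the first part of an earlier walk and the last part of a later one would give a forbidden
  jump.\<close>

lemma jump_total_cost:
  assumes "finite I"
    and R: "\<And>i. i \<in> I \<Longrightarrow> realised (states S) (tpos S) (f i) (f (Suc i)) (N i) (es i) (x i) (y i)"
    and ready: "\<And>i. i \<in> I \<Longrightarrow> jump (states S) (tpos S) (f i) (f (Suc i))"
    and nojump: "\<And>i j. i \<in> I \<Longrightarrow> j \<in> I \<Longrightarrow> i < j \<Longrightarrow> \<not> jump (states S) (tpos S) (f i) (f (Suc j))"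
  shows "(\<Sum>i\<in>I. length (es i)) \<le> 12 * (card (states S))\<^sup>2"
proof -
  let ?E = "tpos S" and ?Q = "states S"
  interpret rev: unit_graph ?Q "flip ` ?E" by (rule flip_graph)
  define n where "n = int (card ?Q)"
  define C D where "C i = scc ?E (fst (f i))" and "D i = scc ?E (fst (f (Suc i)))" for i
  define a b where "a = gain ?E" and "b = gain (flip ` ?E)"
  define \<alpha> \<beta> where "\<alpha> K = int (length (loop ?E K))" and "\<beta> K = int (length (loop (flip ` ?E) K))" for K
  have up: "up ?E (f i) = a (C i)" and down: "down ?E (f (Suc i)) = b (D i)" for i
    by (simp_all add: up_def down_def a_def b_def C_def D_def)
  have CQ: "C ` I \<subseteq> scc ?E ` ?Q" and DQ: "D ` I \<subseteq> scc ?E ` ?Q"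
    using ready by (auto simp: C_def D_def jump_def ready_def)
  have pump: "pumpable ?E (C i)" "pumpable (flip ` ?E) (D i)" if "i \<in> I" for i
    using ready[OF that] by (auto simp: C_def D_def jump_def ready_def scc_flip)
  have a: "a K > 0" "a K \<le> int (card K)" "0 \<le> \<alpha> K" "\<alpha> K \<le> int (card K)" if "K \<in> C ` I" for K
    using pumps_gain[of K] pump that by (auto simp: a_def \<alpha>_def)
  have b: "b K > 0" "b K \<le> int (card K)" "0 \<le> \<beta> K" "\<beta> K \<le> int (card K)" if "K \<in> D ` I" for K
    using rev.pumps_gain[of K] pump that by (auto simp: b_def \<beta>_def)
  have total: "sum h \<K> \<le> n" if "\<K> \<subseteq> scc ?E ` ?Q" "\<And>K. K \<in> \<K> \<Longrightarrow> h K \<le> int (card K)" for \<K> h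
  proof -
    have "sum h \<K> \<le> (\<Sum>K\<in>\<K>. int (card K))" using that(2) by (rule sum_mono)
    also have "\<dots> = int (\<Sum>K\<in>\<K>. card K)" by simp
    also have "\<dots> \<le> n" unfolding n_def using sum_card_scc[OF that(1)] by (rule of_nat_mono)
    finally show ?thesis .
  qed
  \<comment> \<open>Two divisibilities are assumed because either index may be the smaller one; for
    \<open>i = j\<close> the separation is part of \<open>realised\<close>.\<close>
  have sep: "i = j \<and> z = z'"
    if "i \<in> I" "j \<in> I" "(s, z) \<in> N i" "(s, z') \<in> N j" "[z = z'] (mod m)"
      and m: "gcd (a (C i)) (b (D j)) dvd m" "gcd (a (C j)) (b (D i)) dvd m" for i j s z z' m
  proof -
    have *: False if "i \<in> I" "j \<in> I" "i < j" "(s, z) \<in> N i" "(s, z') \<in> N j" "[z = z'] (mod gcd (a (C i)) (b (D j)))"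
      for i j z z'
    proof -
      let ?g = "gcd (a (C i)) (b (D j))"
      have "conn ?E ?g (fst (f i)) (z - int (snd (f i))) s"
        using R[OF that(1)] that(4) conn_mod[of ?E "a (C i)" _ _ _ ?g] up unfolding realised_def by auto
      moreover have "conn ?E ?g s (int (snd (f (Suc j))) - z') (fst (f (Suc j)))"
        using R[OF that(2)] that(5) conn_mod[of ?E "b (D j)" _ _ _ ?g] down unfolding realised_def by auto
      ultimately have "conn ?E ?g (fst (f i)) (z - int (snd (f i)) + (int (snd (f (Suc j))) - z')) (fst (f (Suc j)))"
        by (rule conn_trans)
      then have "conn ?E ?g (fst (f i)) (int (snd (f (Suc j))) - int (snd (f i))) (fst (f (Suc j)))"
        by (rule conn_cong) (use that(6) in \<open>simp add: cong_iff_dvd_diff algebra_simps\<close>)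
      then have "jump ?Q ?E (f i) (f (Suc j))"
        using ready[OF that(1)] ready[OF that(2)] by (simp add: jump_def up down)
      then show False using nojump that(1-3) by blast
    qed
    have "i = j"
      using *[of i j z z'] *[of j i z' z] that cong_dvd_modulus[OF that(5)] cong_sym
      by (meson linorder_neqE_nat)
    moreover have "[z = z'] (mod gcd (a (C i)) (b (D i)))"
      using cong_dvd_modulus[OF that(5)] m \<open>i = j\<close> by simp
    ultimately show ?thesis using R[OF that(1)] that(3,4) up down unfolding realised_def by metis
  qed
  have N: "finite (N i)" "N i \<subseteq> ?Q \<times> UNIV" "\<exists>z. (anchor ?E (C i), z) \<in> N i"
    "\<exists>z. (anchor (flip ` ?E) (D i), z) \<in> N i" if "i \<in> I" for i
    using R[OF that] unfolding realised_def C_def D_def by auto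
  \<comment> \<open>Walks through a common node \<open>u\<close> occupy different residues modulo
    \<open>m\<close> there.\<close>
  have count: "int (card J) \<le> m"
    if "J \<subseteq> I" "m > 0" "\<And>i j. i \<in> J \<Longrightarrow> j \<in> J \<Longrightarrow> gcd (a (C i)) (b (D j)) dvd m"
      and hits: "\<And>i. i \<in> J \<Longrightarrow> \<exists>z. (u, z) \<in> N i" for J m u
  proof -
    let ?N = "\<lambda>i. N i \<inter> {u} \<times> UNIV"
    have fin: "finite J" using that(1) assms(1) finite_subset by blast
    have "int (\<Sum>i\<in>J. card (?N i)) \<le> int (card {u}) * m"
    proof (rule card_separated)
      fix i j s z z' assume "i \<in> J" "j \<in> J" "(s, z) \<in> ?N i" "(s, z') \<in> ?N j" "[z = z'] (mod m)"
      then show "i = j \<and> z = z'" using sep[of i j s z z' m] that(1,3) by blast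
    qed (use fin N(1) that(1,2) in auto)
    moreover have "card J \<le> (\<Sum>i\<in>J. card (?N i))"
    proof -
      have "(\<Sum>i\<in>J. 1) \<le> (\<Sum>i\<in>J. card (?N i))"
      proof (rule sum_mono)
        fix i assume i: "i \<in> J"
        then obtain z where "(u, z) \<in> ?N i" using hits by blast
        moreover have "finite (?N i)" using N(1) that(1) i by blast
        ultimately have "0 < card (?N i)" by (auto simp: card_gt_0_iff)
        then show "1 \<le> card (?N i)" by simp
      qed
      then show ?thesis by simp
    qed
    then have "int (card J) \<le> int (\<Sum>i\<in>J. card (?N i))" by (rule of_nat_mono)
    ultimately show ?thesis by simp
  qed
  have nodes: "(\<Sum>i\<in>J. int (card (N i))) \<le> n * m"
    if "J \<subseteq> I" "m > 0" "\<And>i j. i \<in> J \<Longrightarrow> j \<in> J \<Longrightarrow> gcd (a (C i)) (b (D j)) dvd m" for J m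
  proof -
    have "finite J" using that(1) assms(1) finite_subset by blast
    then have "int (\<Sum>i\<in>J. card (N i)) \<le> int (card ?Q) * m"
    proof (rule card_separated)
      fix i j s z z' assume "i \<in> J" "j \<in> J" "(s, z) \<in> N i" "(s, z') \<in> N j" "[z = z'] (mod m)"
      then show "i = j \<and> z = z'" using sep[of i j s z z' m] that(1,3) by blast
    qed (use finite_Q N(1,2) that(1,2) in auto)
    then show ?thesis by (simp add: n_def)
  qed
  \<comment> \<open>All walks leaving \<open>K\<close> pass its anchor, and every gcd involved
    divides \<open>a K\<close>.\<close>
  have C_count: "int (card {i \<in> I. C i = K}) \<le> a K" if "K \<in> C ` I" for K
    using N(3) by (intro count[of _ _ "anchor ?E K"] a(1) that) auto
  have D_count: "int (card {i \<in> I. D i = K}) \<le> b K" if "K \<in> D ` I" for K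
    using N(4) by (intro count[of _ _ "anchor (flip ` ?E) K"] b(1) that) auto
  have pair: "int (card {i \<in> I. C i = K \<and> D i = L}) \<le> gcd (a K) (b L)" if "K \<in> C ` I" for K L
    using N(3) a(1)[OF that] by (intro count[of _ _ "anchor ?E K"]) (auto simp: gcd_pos_int)
  have C_nodes: "(\<Sum>i | i \<in> I \<and> C i = K. int (card (N i))) \<le> n * a K" if "K \<in> C ` I" for K
    by (intro nodes a(1) that) auto
  have D_nodes: "(\<Sum>i | i \<in> I \<and> D i = K. int (card (N i))) \<le> n * b K" if "K \<in> D ` I" for K
    by (intro nodes b(1) that) auto
  have n0: "n \<ge> 0" by (simp add: n_def)
  \<comment> \<open>The factor \<open>3 * n\<close> consists of \<open>n\<close> for the nodes of
    the walks and \<open>2 * n\<close> for each of at most \<open>a K\<close> jumps.\<close>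
  have X: "(\<Sum>i\<in>I. int (x i) * \<alpha> (C i)) \<le> (3 * n + n) * n"
  proof (rule pump_cost[where a = a and b = b and D = D and w = "\<lambda>i. int (card (N i)) + 2 * n"])
    fix i assume "i \<in> I"
    from R[OF this] show "int (x i) * a (C i) \<le> int (card (N i)) + 2 * n
        + a (C i) * (b (D i) div gcd (a (C i)) (b (D i)))"
      unfolding realised_def up down by (simp add: n_def)
  next
    fix K assume K: "K \<in> C ` I"
    have "(\<Sum>i | i \<in> I \<and> C i = K. int (card (N i)) + 2 * n)
        \<le> n * a K + int (card {i \<in> I. C i = K}) * (2 * n)"
      using C_nodes[OF K] by (simp add: sum.distrib)
    also have "\<dots> \<le> n * a K + a K * (2 * n)"
      using C_count[OF K] n0 by (intro add_left_mono mult_right_mono) auto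
    finally show "(\<Sum>i | i \<in> I \<and> C i = K. int (card (N i)) + 2 * n) \<le> 3 * n * a K"
      by (simp add: algebra_simps)
  qed (use assms(1) a b n0 pair total[OF CQ] total[OF DQ] in auto)
  \<comment> \<open>The roles of the two directions are exchanged; \<open>4 * n\<close> arises since
    \<open>card N\<close> enters twice.\<close>
  have Y: "(\<Sum>i\<in>I. int (y i) * \<beta> (D i)) \<le> (4 * n + n) * n"
  proof (rule pump_cost[where a = b and b = a and D = C and w = "\<lambda>i. 2 * int (card (N i)) + 2 * n"])
    fix i assume "i \<in> I"
    from R[OF this] show "int (y i) * b (D i) \<le> 2 * int (card (N i)) + 2 * n
        + b (D i) * (a (C i) div gcd (b (D i)) (a (C i)))"
      unfolding realised_def up down by (simp add: n_def gcd.commute)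
  next
    fix K assume K: "K \<in> D ` I"
    have "(\<Sum>i | i \<in> I \<and> D i = K. 2 * int (card (N i)) + 2 * n)
        \<le> 2 * (n * b K) + int (card {i \<in> I. D i = K}) * (2 * n)"
      using D_nodes[OF K] by (simp add: sum.distrib flip: sum_distrib_left)
    also have "\<dots> \<le> 2 * (n * b K) + b K * (2 * n)"
      using D_count[OF K] n0 by (intro add_left_mono mult_right_mono) auto
    finally show "(\<Sum>i | i \<in> I \<and> D i = K. 2 * int (card (N i)) + 2 * n) \<le> 4 * n * b K"
      by (simp add: algebra_simps)
  next
    fix K L assume "K \<in> D ` I" "L \<in> C ` I"
    then show "int (card {i \<in> I. D i = K \<and> C i = L}) \<le> gcd (b K) (a L)"
      using pair[of L K] by (simp add: gcd.commute conj_commute)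
  qed (use assms(1) a b n0 total[OF CQ] total[OF DQ] in auto)
  have "int (card I) = (\<Sum>K\<in>C ` I. int (card {i \<in> I. C i = K}))"
    using sum.image_gen[OF assms(1), of "\<lambda>_. 1 :: int" C] by simp
  also have "\<dots> \<le> (\<Sum>K\<in>C ` I. a K)" using C_count by (rule sum_mono)
  also have "\<dots> \<le> n" using a by (intro total[OF CQ]) auto
  finally have cI: "int (card I) \<le> n" .
  have "(\<Sum>i\<in>I. int (card (N i))) = (\<Sum>K\<in>C ` I. \<Sum>i | i \<in> I \<and> C i = K. int (card (N i)))"
    by (rule sum.image_gen[OF assms(1)])
  also have "\<dots> \<le> (\<Sum>K\<in>C ` I. n * a K)" using C_nodes by (rule sum_mono)
  also have "\<dots> \<le> n * n"
    unfolding sum_distrib_left[symmetric] using a n0 by (intro mult_left_mono total[OF CQ]) auto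
  finally have cN: "(\<Sum>i\<in>I. int (card (N i))) \<le> n * n" .
  have "int (length (es i)) \<le> 2 * n + int (x i) * \<alpha> (C i) + int (card (N i)) + int (y i) * \<beta> (D i)"
    if "i \<in> I" for i
  proof -
    have "length (es i) \<le> 2 * card ?Q + x i * length (loop ?E (C i)) + card (N i)
        + y i * length (loop (flip ` ?E) (D i))"
      using R[OF that] unfolding realised_def C_def D_def by blast
    then have "int (length (es i)) \<le> int \<dots>" by (rule of_nat_mono)
    then show ?thesis by (simp add: n_def \<alpha>_def \<beta>_def)
  qed
  then have "(\<Sum>i\<in>I. int (length (es i))) \<le>
      (\<Sum>i\<in>I. 2 * n + int (x i) * \<alpha> (C i) + int (card (N i)) + int (y i) * \<beta> (D i))"
    by (rule sum_mono)
  also have "\<dots> = int (card I) * (2 * n) + (\<Sum>i\<in>I. int (x i) * \<alpha> (C i)) + (\<Sum>i\<in>I. int (card (N i)))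
      + (\<Sum>i\<in>I. int (y i) * \<beta> (D i))"
    by (simp add: sum.distrib)
  \<comment> \<open>Detours, upward cycles, connecting walks and downward cycles: 2 + 4 + 1 + 5 =
    12.\<close>
  also have "\<dots> \<le> n * (2 * n) + (3 * n + n) * n + n * n + (4 * n + n) * n"
    using cI n0 X Y cN by (intro add_mono mult_right_mono) auto
  also have "\<dots> = int (12 * (card ?Q)\<^sup>2)" by (simp add: n_def power2_eq_square algebra_simps)
  finally show ?thesis unfolding of_nat_sum[symmetric] of_nat_le_iff .
qed

text \<open>A shortest sequence of low moves has no repeated configuration and no shortcut jump; its
  jumps are then replaced by the walks realising them.\<close>

lemma short_path:
  assumes "(\<alpha>, \<beta>) \<in> (low_move S)\<^sup>*" "\<alpha> \<in> states S \<times> {..card (states S) + 1}"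
  shows "\<exists>\<pi>. is_path S \<alpha> \<pi> \<beta> \<and> length \<pi> \<le> 14 * (card (states S))\<^sup>2"
proof -
  let ?n = "card (states S)"
  obtain r where r: "(\<alpha>, \<beta>) \<in> low_move S ^^ r"
    and min: "\<And>k. (\<alpha>, \<beta>) \<in> low_move S ^^ k \<Longrightarrow> r \<le> k"
    using assms(1) ex_has_least_nat[of "\<lambda>k. (\<alpha>, \<beta>) \<in> low_move S ^^ k" _ "\<lambda>k. k"]
    by (metis rtrancl_imp_relpow)
  obtain f where f: "f 0 = \<alpha>" "f r = \<beta>" "\<And>i. i < r \<Longrightarrow> (f i, f (Suc i)) \<in> low_move S"
    using r unfolding relpow_fun_conv by blast
  have seg: "(f i, f j) \<in> low_move S ^^ (j - i)" if "i \<le> j" "j \<le> r" for i j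
    unfolding relpow_fun_conv using that f(3) by (intro exI[of _ "\<lambda>k. f (i + k)"]) auto
  \<comment> \<open>Every segment of a shortest sequence is itself shortest.\<close>
  have geodesic: "j - i \<le> k" if "i \<le> j" "j \<le> r" "(f i, f j) \<in> low_move S ^^ k" for i j k
  proof -
    have "(\<alpha>, f j) \<in> low_move S ^^ (i + k)"
      unfolding relpow_add using seg[of 0 i] that f(1) by auto
    then have "(\<alpha>, \<beta>) \<in> low_move S ^^ (i + k + (r - j))"
      unfolding relpow_add[of "i + k"] using seg[of j r] that f(2) by auto
    then show ?thesis using min that(1,2) by fastforce
  qed
  have "inj_on f {..r}"
  proof (rule linorder_inj_onI)
    fix i j assume "i < j" "j \<in> {..r}"
    then show "f i \<noteq> f j" using geodesic[of i j 0] by auto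
  qed auto
  moreover have "f ` {..r} \<subseteq> states S \<times> {..?n + 1}"
  proof (intro image_subsetI)
    fix i assume "i \<in> {..r}"
    then show "f i \<in> states S \<times> {..?n + 1}"
      using f(1) assms(2) low_move_nodes(2)[OF f(3)] by (cases i) auto
  qed
  ultimately have "card {..r} \<le> card (states S \<times> {..?n + 1})"
    using finite_Q by (intro card_inj_on_le) auto
  then have rn: "r + 1 \<le> ?n * (?n + 2)" by (simp add: card_cartesian_product)
  define I where "I = {i. i < r \<and> (f i, f (Suc i)) \<notin> low_step S}"
  have J: "jump (states S) (tpos S) (f i) (f (Suc i))" if "i \<in> I" for i
    using that f(3) by (auto simp: I_def low_move_def)
  obtain N es x y where R:
    "\<And>i. i \<in> I \<Longrightarrow> realised (states S) (tpos S) (f i) (f (Suc i)) (N i) (es i) (x i) (y i)"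
    using jump_realised[OF J] by metis
  have "\<not> jump (states S) (tpos S) (f i) (f (Suc j))" if "i \<in> I" "j \<in> I" "i < j" for i j
  proof
    assume "jump (states S) (tpos S) (f i) (f (Suc j))"
    then have "(f i, f (Suc j)) \<in> low_move S ^^ 1" by (simp add: low_move_def)
    \<comment> \<open>The shortcut would replace at least two moves by one.\<close>
    then show False using geodesic[of i "Suc j" 1] that by (auto simp: I_def)
  qed
  then have cost: "(\<Sum>i\<in>I. length (es i)) \<le> 12 * ?n\<^sup>2"
    using R J by (intro jump_total_cost[of I f N es x y]) (auto simp: I_def)
  let ?c = "\<lambda>i. if i \<in> I then length (es i) else 1"
  have "\<exists>\<pi>. is_path S \<alpha> \<pi> (f j) \<and> length \<pi> = (\<Sum>i<j. ?c i)" if "j \<le> r" for j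
    using that
  proof (induction j)
    case 0
    show ?case using f(1) by (auto intro: exI[of _ "[]"])
  next
    case (Suc j)
    then obtain \<pi> where \<pi>: "is_path S \<alpha> \<pi> (f j)" "length \<pi> = (\<Sum>i<j. ?c i)" by auto
    have "\<exists>\<rho>. is_path S (f j) \<rho> (f (Suc j)) \<and> length \<rho> = ?c j"
    proof (cases "j \<in> I")
      case True
      have "walk (tpos S) (fst (f j)) (es j) (fst (f (Suc j)))" "psafe (int (snd (f j))) (es j)"
        "int (snd (f j)) + eff (es j) = int (snd (f (Suc j)))"
        using R[OF True] unfolding realised_def by auto
      then show ?thesis using run_is_path[of S "fst (f j)" "es j"] True by fastforce
    next
      case False
      then obtain t where "step S (f j) t (f (Suc j))"
        using Suc.prems by (auto simp: I_def low_step_def)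
      then show ?thesis using False by (intro exI[of _ "[(f j, t)]"]) (metis (no_types, lifting)
        is_path.simps length_Cons list.size(3) One_nat_def)
    qed
    then obtain \<rho> where "is_path S (f j) \<rho> (f (Suc j))" "length \<rho> = ?c j" by blast
    then show ?case using is_path_append[OF \<pi>(1)] \<pi>(2) by (intro exI[of _ "\<pi> @ \<rho>"]) simp
  qed
  from this[of r] obtain \<pi> where \<pi>: "is_path S \<alpha> \<pi> \<beta>" "length \<pi> = (\<Sum>i<r. ?c i)"
    using f(2) by auto
  have "(\<Sum>i<r. ?c i) \<le> (\<Sum>i<r. (if i \<in> I then length (es i) else 0) + 1)"
    by (intro sum_mono) auto
  also have "\<dots> = (\<Sum>i\<in>I. length (es i)) + r"
  proof -
    have "{..<r} \<inter> I = I" by (auto simp: I_def)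
    then show ?thesis using sum.inter_restrict[of "{..<r}" "\<lambda>i. length (es i)" I]
      by (simp only: sum.distrib) simp
  qed
  also have "\<dots> \<le> 14 * ?n\<^sup>2"
  proof -
    \<comment> \<open>With \<open>rn\<close> this gives at most \<open>2 * ?n\<^sup>2\<close> moves,
      each charged one unit on top of the cost of the jumps.\<close>
    have "2 * ?n \<le> ?n\<^sup>2 + 1" by (cases ?n) (auto simp: power2_eq_square)
    then show ?thesis using cost rn by (simp add: power2_eq_square algebra_simps)
  qed
  finally show ?thesis using \<pi> by auto
qed

end

theorem theorem1:
  fixes S :: "'q ocs" and p\<^sub>\<alpha> p\<^sub>\<beta> :: 'q and n :: nat
  assumes "wf_ocs S"
    and "card (states S) = n"
    and "p\<^sub>\<alpha> \<in> states S" and "p\<^sub>\<beta> \<in> states S"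
    and "reachable S (p\<^sub>\<alpha>, 0) (p\<^sub>\<beta>, 0)"
  shows "\<exists>\<pi>. is_path S (p\<^sub>\<alpha>, 0) \<pi> (p\<^sub>\<beta>, 0) \<and> length \<pi> \<le> 14 * n^2"
proof -
  interpret one_counter S using assms(1) by unfold_locales
  obtain \<pi> where "is_path S (p\<^sub>\<alpha>, 0) \<pi> (p\<^sub>\<beta>, 0)"
    using assms(5) unfolding reachable_def by blast
  then have "((p\<^sub>\<alpha>, 0), (p\<^sub>\<beta>, 0)) \<in> (low_move S)\<^sup>*"
    using assms(3) by (rule reachable_low_move)
  then show ?thesis using short_path assms(2,3) by auto
qed

end
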